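(* For every integer $n\ge 0$, $$[\mathrm{CW}(n)]_q = q\,\mathrm{CW}_q(n).$$
   Context: A hyperbinary partition of an integer $n\ge 0$ is a partition of $n$ in which every part is a power of $2$ and each part occurs at most twice. Let $H(n)$ be the set of hyperbinary partitions of $n$ (with $H(0)=\{\text{empty partition}\}$, $H(-1)=\emptyset$), and let $h_q(n)=\sum_{\eta\in H(n)} q^{\ell(\eta)}$, where $\ell(\eta)$ is the number of parts of $\eta$ (so $h_q(-1)=0$, $h_q(0)=1$). Stern's diatomic sequence is defined by $\mathrm{fusc}(0)=0$, $\mathrm{fusc}(1)=1$, and for $n\ge1$: $\mathrm{fusc}(2n)=\mathrm{fusc}(n)$, $\mathrm{fusc}(2n+1)=\mathrm{fusc}(n)+\mathrm{fusc}(n+1)$. The Calkin–Wilf sequence is $\mathrm{CW}(n)=\mathrm{fusc}(n)/\mathrm{fusc}(n+1)$ for $n\ge0$. The $q$-Calkin–Wilf sequence is $\mathrm{CW}_q(0)=0$ and $\mathrm{CW}_q(n)=h_q(n-1)/h_q(n)$ for $n\ge1$. $q$-deformed rationals (Morier-Genoud–Ovsienko): $[0]_q=0$. For a positive rational $x$, write a continued fraction $x=a_1+\cfrac{1}{a_2+\cfrac{1}{\ddots+\cfrac{1}{a_m}}}$ with $a_1\ge0$ and $a_2,\dots,a_m\ge1$ integers. Then $[x]_q$ is the rational function obtained by replacing each $a_i$ by $[a_i]_q=1+q+\dots+q^{a_i-1}$ if $i$ is odd and by $[a_i]_{q^{-1}}$ if $i$ is even, and replacing the numerator $1$ of the fraction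 that follows $a_i$ by $q^{a_i}$ if $i$ is odd and by $q^{-a_i}$ if $i$ is even; i.e. $[x]_q=[a_1]_q+\cfrac{q^{a_1}}{[a_2]_{q^{-1}}+\cfrac{q^{-a_2}}{\ddots}}$. This does not depend on the choice of continued fraction expansion. *)

theory Defs
  imports
    "HOL-Library.Multiset"
    "HOL-Computational_Algebra.Polynomial"
    "HOL-Computational_Algebra.Fraction_Field"
begin

definition hyperbinary_partitions :: "nat \<Rightarrow> nat multiset set" where
  "hyperbinary_partitions n =
     {\<eta>. (\<forall>p \<in># \<eta>. \<exists>k. p = 2 ^ k) \<and> (\<forall>p. count \<eta> p \<le> 2) \<and> sum_mset \<eta> = n}"

definition hq :: "nat \<Rightarrow> int poly" where
  "hq n = (\<Sum>\<eta> \<in> hyperbinary_partitions n. monom 1 (size \<eta>))"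

function fusc :: "nat \<Rightarrow> nat" where
  "fusc n =
     (if n = 0 then 0
      else if n = 1 then 1
      else if even n then fusc (n div 2)
      else fusc (n div 2) + fusc (n div 2 + 1))"
  by pat_completeness auto
termination
  by (relation "measure id") (auto elim!: oddE)

declare fusc.simps [simp del]

lemma fusc_0: "fusc 0 = 0"
  by (subst fusc.simps) simp

lemma fusc_1: "fusc 1 = 1"
  by (subst fusc.simps) simp

lemma fusc_double: "n \<ge> 1 \<Longrightarrow> fusc (2 * n) = fusc n"
  by (subst fusc.simps) simp

lemma fusc_double_plus_1: "n \<ge> 1 \<Longrightarrow> fusc (2 * n + 1) = fusc n + fusc (n + 1)"
  by (subst fusc.simps) simp

definition CW :: "nat \<Rightarrow> rat" where
  "CW n = of_nat (fusc n) / of_nat (fusc (n + 1))"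

definition q :: "int poly fract" where
  "q = Fract [:0, 1:] 1"

definition CW_q :: "nat \<Rightarrow> int poly fract" where
  "CW_q n = (if n = 0 then 0 else Fract (hq (n - 1)) (hq n))"

fun cf_value :: "nat list \<Rightarrow> rat" where
  "cf_value [] = 0"
| "cf_value [a] = of_nat a"
| "cf_value (a # b # as) = of_nat a + 1 / cf_value (b # as)"

definition cf_expansion :: "nat list \<Rightarrow> rat \<Rightarrow> bool" where
  "cf_expansion as x \<longleftrightarrow> as \<noteq> [] \<and> (\<forall>a \<in> set (tl as). a \<ge> 1) \<and> cf_value as = x"

definition q_int :: "'a::field \<Rightarrow> nat \<Rightarrow> 'a" where
  "q_int z a = (\<Sum>i<a. z ^ i)"

text \<open>
  The base is inverted at every step of the recursion, so that starting from \<open>z\<close> the entries in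
  odd position are deformed with base \<open>z\<close> and those in even position with base \<open>inverse z\<close>.
\<close>
fun q_cf_value :: "'a::field \<Rightarrow> nat list \<Rightarrow> 'a" where
  "q_cf_value z [] = 0"
| "q_cf_value z [a] = q_int z a"
| "q_cf_value z (a # b # as) = q_int z a + z ^ a / q_cf_value (inverse z) (b # as)"

text \<open>
  The definite description expresses the independence of the chosen continued fraction expansion.
  The value is meaningful for \<open>x \<ge> 0\<close> only; a negative \<open>x\<close> has no expansion of this form.
\<close>
definition q_rational :: "rat \<Rightarrow> int poly fract" where
  "q_rational x =
     (if x = 0 then 0 else (THE y. \<exists>as. cf_expansion as x \<and> y = q_cf_value q as))"

end

theory Submission imports Defs begin

text \<open>
  Splitting off the parts equal to \<open>1\<close> and halving the others gives
  \<open>h(2n + 1) = q h(n)\<close> and \<open>h(2n) = h(n) + q\<^sup>2 h(n - 1)\<close>. Hence \<open>y(n) = q CW\<^sub>q(n)\<close> satisfies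
  \<open>y(2n + 1) = 1 + q y(n)\<close> and \<open>y(2n) = q y(n) / (1 + q y(n))\<close>, the \<open>q\<close>-analogues of
  \<open>CW(2n + 1) = 1 + CW(n)\<close> and \<open>CW(2n) = CW(n) / (1 + CW(n))\<close>. On continued fractions the two moves
  of the Calkin-Wilf tree alter only the first entries, and \<open>q\<close>-deformed values change accordingly.
  Running the moves backwards on an arbitrary expansion of \<open>CW(n)\<close> shows that each of its expansions
  has \<open>q\<close>-value \<open>y(n)\<close>, so independence of the expansion comes out of the same induction.
\<close>

section \<open>Hyperbinary partitions\<close>

text \<open>Inverse of splitting off the \<open>c\<close> parts equal to 1 and halving the others;
  it leads from partitions of \<open>n\<close> to partitions of \<open>2 * n + c\<close>.\<close>

definition attach_ones :: "nat \<Rightarrow> nat multiset \<Rightarrow> nat multiset" where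
  "attach_ones c \<eta> = replicate_mset c 1 + image_mset ((*) 2) \<eta>"

lemma size_attach_ones [simp]: "size (attach_ones c \<eta>) = c + size \<eta>"
  by (simp add: attach_ones_def)

lemma count_image_mset_double: "count (image_mset ((*) 2) \<eta>) (2 * p) = count \<eta> (p::nat)"
  by (induction \<eta>) auto

lemma count_image_mset_double_odd: "odd p \<Longrightarrow> count (image_mset ((*) 2) \<eta>) (p::nat) = 0"
  by (auto simp: count_eq_zero_iff)

lemma count_attach_ones_1 [simp]: "count (attach_ones c \<eta>) 1 = c"
  using count_image_mset_double_odd[of 1 \<eta>] by (simp add: attach_ones_def)

text \<open>Doubled parts are even, so \<open>c\<close> is recovered as the multiplicity of 1, and
  then \<open>\<eta>\<close> from the multiplicities of the even parts.\<close>

lemma attach_ones_inject: "attach_ones c \<eta> = attach_ones c' \<eta>' \<longleftrightarrow> c = c' \<and> \<eta> = \<eta>'"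
proof
  assume eq: "attach_ones c \<eta> = attach_ones c' \<eta>'"
  then have c: "c = c'"
    by (metis count_attach_ones_1)
  with eq have "image_mset ((*) 2) \<eta> = image_mset ((*) 2) \<eta>'"
    by (simp add: attach_ones_def)
  then show "c = c' \<and> \<eta> = \<eta>'"
    using c by (metis count_image_mset_double multiset_eqI)
qed simp

text \<open>Added ones and doubled parts never coincide, so each multiplicity is 0,
  \<open>c\<close>, or inherited from \<open>\<eta>\<close>.\<close>

lemma attach_ones_in_hyperbinary:
  assumes "\<eta> \<in> hyperbinary_partitions n" "c \<le> 2"
  shows "attach_ones c \<eta> \<in> hyperbinary_partitions (2 * n + c)"
proof -
  have "\<exists>k. p = 2 ^ k" if "p \<in># attach_ones c \<eta>" for p
  proof -
    from that consider "p = 1" | r where "r \<in># \<eta>" "p = 2 * r"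
      by (auto simp: attach_ones_def split: if_splits)
    then show ?thesis
    proof cases
      case 1
      then show ?thesis by (intro exI[of _ 0]) simp
    next
      case 2
      with assms obtain k where "r = 2 ^ k"
        by (auto simp: hyperbinary_partitions_def)
      with 2 show ?thesis by (intro exI[of _ "Suc k"]) simp
    qed
  qed
  moreover have "count (attach_ones c \<eta>) p \<le> 2" for p
  proof (cases "even p")
    case True
    then obtain r where "p = 2 * r" by blast
    moreover from this have "count (attach_ones c \<eta>) p = count \<eta> r"
      by (simp add: attach_ones_def count_image_mset_double)
    ultimately show ?thesis
      using assms by (simp add: hyperbinary_partitions_def)
  next
    case False
    then show ?thesis
      using assms by (simp add: attach_ones_def count_image_mset_double_odd)
  qed
  moreover have "sum_mset (attach_ones c \<eta>) = 2 * n + c"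
    using assms
    by (simp add: attach_ones_def hyperbinary_partitions_def flip: sum_mset_distrib_left)
  ultimately show ?thesis
    by (simp add: hyperbinary_partitions_def)
qed

text \<open>A power of 2 other than 1 is even, so halving all parts other than 1 loses
  nothing.\<close>

lemma hyperbinary_cases:
  assumes "\<mu> \<in> hyperbinary_partitions m"
  obtains c n \<eta> where "c \<le> 2" "m = 2 * n + c" "\<eta> \<in> hyperbinary_partitions n"
    "\<mu> = attach_ones c \<eta>"
proof -
  define c where "c = count \<mu> 1"
  define \<nu> where "\<nu> = filter_mset (\<lambda>p. p \<noteq> 1) \<mu>"
  define \<eta> where "\<eta> = image_mset (\<lambda>p. p div 2) \<nu>"
  have pow: "\<exists>k. p = 2 * 2 ^ k" if "p \<in># \<nu>" for p
  proof -
    from that assms obtain k where "p = 2 ^ k" "p \<noteq> 1"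
      by (auto simp: \<nu>_def hyperbinary_partitions_def)
    then show ?thesis by (cases k) auto
  qed
  have "image_mset ((*) 2) \<eta> = image_mset id \<nu>"
    unfolding \<eta>_def multiset.map_comp
    by (rule image_mset_cong) (use pow in fastforce)
  then have double: "image_mset ((*) 2) \<eta> = \<nu>" by simp
  have "\<mu> = filter_mset (\<lambda>p. p = 1) \<mu> + \<nu>"
    unfolding \<nu>_def by (rule multiset_partition)
  then have \<mu>: "\<mu> = attach_ones c \<eta>"
    by (simp add: attach_ones_def double c_def filter_eq_replicate_mset)
  have "m = sum_mset \<mu>"
    using assms by (simp add: hyperbinary_partitions_def)
  then have m: "m = 2 * sum_mset \<eta> + c"
    unfolding \<mu> by (simp add: attach_ones_def flip: sum_mset_distrib_left)
  have "count \<eta> p \<le> 2" for p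
  proof -
    have "count \<eta> p = count \<nu> (2 * p)"
      by (simp add: count_image_mset_double flip: double)
    also have "\<dots> \<le> count \<mu> (2 * p)"
      by (simp add: \<nu>_def)
    also have "\<dots> \<le> 2"
      using assms by (simp add: hyperbinary_partitions_def)
    finally show ?thesis .
  qed
  moreover have "\<forall>p\<in>#\<eta>. \<exists>k. p = 2 ^ k"
    using pow by (fastforce simp: \<eta>_def)
  ultimately have "\<eta> \<in> hyperbinary_partitions (sum_mset \<eta>)"
    by (simp add: hyperbinary_partitions_def)
  moreover have "c \<le> 2"
    using assms by (simp add: c_def hyperbinary_partitions_def)
  ultimately show thesis
    using m \<mu> that by blast
qed

lemma hyperbinary_0: "hyperbinary_partitions 0 = {{#}}"
proof -
  have "\<eta> = {#}" if "\<forall>p\<in>#\<eta>. \<exists>k. p = (2::nat) ^ k" "sum_mset \<eta> = 0" for \<eta>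
  proof (cases \<eta>)
    case (add p \<nu>)
    with that obtain k where "p = 2 ^ k" by auto
    with that add show ?thesis by simp
  qed
  then show ?thesis
    by (auto simp: hyperbinary_partitions_def)
qed

lemma hyperbinary_odd:
  "hyperbinary_partitions (2 * n + 1) = attach_ones 1 ` hyperbinary_partitions n"
proof
  show "hyperbinary_partitions (2 * n + 1) \<subseteq> attach_ones 1 ` hyperbinary_partitions n"
  proof
    fix \<mu> assume "\<mu> \<in> hyperbinary_partitions (2 * n + 1)"
    then obtain c k \<eta> where *: "c \<le> 2" "2 * n + 1 = 2 * k + c"
      "\<eta> \<in> hyperbinary_partitions k" "\<mu> = attach_ones c \<eta>"
      by (rule hyperbinary_cases)
    then have "c = 1 \<and> k = n" by presburger
    with * show "\<mu> \<in> attach_ones 1 ` hyperbinary_partitions n" by blast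
  qed
qed (use attach_ones_in_hyperbinary[of _ n 1] in auto)

text \<open>Parity leaves \<open>c = 0\<close> or \<open>c = 2\<close>. The form
  \<open>2 * Suc n\<close> avoids the index -1.\<close>

lemma hyperbinary_even:
  "hyperbinary_partitions (2 * Suc n) =
     attach_ones 0 ` hyperbinary_partitions (Suc n) \<union> attach_ones 2 ` hyperbinary_partitions n"
proof
  show "hyperbinary_partitions (2 * Suc n) \<subseteq>
    attach_ones 0 ` hyperbinary_partitions (Suc n) \<union> attach_ones 2 ` hyperbinary_partitions n"
  proof
    fix \<mu> assume "\<mu> \<in> hyperbinary_partitions (2 * Suc n)"
    then obtain c k \<eta> where *: "c \<le> 2" "2 * Suc n = 2 * k + c"
      "\<eta> \<in> hyperbinary_partitions k" "\<mu> = attach_ones c \<eta>"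
      by (rule hyperbinary_cases)
    then have "c = 0 \<and> k = Suc n \<or> c = 2 \<and> k = n" by presburger
    with * show "\<mu> \<in> attach_ones 0 ` hyperbinary_partitions (Suc n)
        \<union> attach_ones 2 ` hyperbinary_partitions n" by blast
  qed
qed (use attach_ones_in_hyperbinary[of _ n 2] attach_ones_in_hyperbinary[of _ "Suc n" 0] in auto)

text \<open>Needed to split the sum \<open>hq\<close> over a disjoint union and to get a positive
  cardinality.\<close>

lemma finite_hyperbinary: "finite (hyperbinary_partitions n)"
proof (induction n rule: less_induct)
  case (less n)
  consider "n = 0" | k where "n = 2 * k + 1" | k where "n = 2 * Suc k"
  proof -
    have "n = 0 \<or> (\<exists>k. n = 2 * k + 1) \<or> (\<exists>k. n = 2 * Suc k)"
      by presburger
    then show ?thesis using that by blast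
  qed
  then show ?case
  proof cases
    case 1
    then show ?thesis by (simp add: hyperbinary_0)
  next
    case 2
    with less.IH[of k] show ?thesis by (simp only: hyperbinary_odd) simp
  next
    case 3
    with less.IH[of k] less.IH[of "Suc k"] show ?thesis by (simp only: hyperbinary_even) simp
  qed
qed

section \<open>Recurrences for the polynomials \<open>hq\<close>\<close>

lemma sum_attach_ones:
  "(\<Sum>\<eta> \<in> attach_ones c ` A. monom 1 (size \<eta>)) =
     monom 1 c * (\<Sum>\<eta> \<in> A. monom (1::int) (size \<eta>))"
proof -
  have "inj_on (attach_ones c) A"
    by (simp add: inj_on_def attach_ones_inject)
  then show ?thesis
    by (simp add: sum.reindex sum_distrib_left mult_monom)
qed

lemma hq_0: "hq 0 = 1"
  by (simp add: hq_def hyperbinary_0)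

lemma hq_odd: "hq (2 * n + 1) = monom 1 1 * hq n"
  unfolding hq_def hyperbinary_odd by (rule sum_attach_ones)

lemma hq_even: "hq (2 * Suc n) = hq (Suc n) + monom 1 2 * hq n"
proof -
  \<comment> \<open>Members of the two images have no part 1 and two parts 1, respectively.\<close>
  have "attach_ones 0 ` hyperbinary_partitions (Suc n) \<inter> attach_ones 2 ` hyperbinary_partitions n = {}"
    by (auto simp: attach_ones_inject)
  then have "hq (2 * Suc n) = monom 1 0 * hq (Suc n) + monom 1 2 * hq n"
    unfolding hq_def hyperbinary_even
    by (simp only: sum.union_disjoint finite_imageI finite_hyperbinary sum_attach_ones)
  then show ?thesis by simp
qed

text \<open>Evaluation at 1 counts the partitions, and there is at least one.\<close>

lemma hq_nonzero: "hq n \<noteq> 0"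
proof -
  have "poly (hq n) 1 = int (card (hyperbinary_partitions n))"
    by (simp add: hq_def poly_sum poly_monom)
  moreover have "hyperbinary_partitions n \<noteq> {}"
  proof (induction n rule: nat_bit_induct)
    case zero
    then show ?case by (simp add: hyperbinary_0)
  next
    case (even n)
    then show ?case by (cases n) (simp_all only: hyperbinary_even, auto)
  next
    case (odd n)
    then show ?case using hyperbinary_odd[of n] by simp
  qed
  ultimately show ?thesis
    using finite_hyperbinary[of n] by auto
qed

section \<open>Recurrences along the Calkin-Wilf tree\<close>

text \<open>Embedding into the fraction field, where \<open>CW_q\<close> becomes a quotient of field
  elements.\<close>

definition hq_fract :: "nat \<Rightarrow> int poly fract" where
  "hq_fract n = Fract (hq n) 1"

lemma q_power: "q ^ n = Fract (monom 1 n) 1"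
  by (induction n) (simp_all add: q_def One_fract_def monom_0 monom_Suc one_pCons)

lemma q_nonzero: "q \<noteq> 0"
  by (simp add: q_def Zero_fract_def eq_fract)

lemma CW_q_Suc: "CW_q (Suc n) = hq_fract n / hq_fract (Suc n)"
  by (simp add: CW_q_def hq_fract_def)

lemma hq_fract_nonzero: "hq_fract n \<noteq> 0"
  by (simp add: hq_fract_def Zero_fract_def eq_fract hq_nonzero)

lemma hq_fract_0: "hq_fract 0 = 1"
  by (simp add: hq_fract_def hq_0 One_fract_def)

lemma hq_fract_odd: "hq_fract (Suc (2 * n)) = q * hq_fract n"
proof -
  have "q * hq_fract n = q ^ 1 * Fract (hq n) 1"
    by (simp add: hq_fract_def)
  also have "\<dots> = Fract (monom 1 1 * hq n) 1"
    unfolding q_power by simp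
  finally show ?thesis
    using hq_odd[of n] by (simp add: hq_fract_def)
qed

lemma hq_fract_even: "hq_fract (2 * Suc n) = hq_fract (Suc n) + q\<^sup>2 * hq_fract n"
  unfolding hq_fract_def hq_even q_power by simp

lemma CW_q_nonzero: "n > 0 \<Longrightarrow> CW_q n \<noteq> 0"
  by (cases n) (simp_all add: CW_q_Suc hq_fract_nonzero)

lemma CW_q_odd: "q * CW_q (Suc (2 * n)) = 1 + q * (q * CW_q n)"
proof (cases n)
  \<comment> \<open>\<open>CW_q 0\<close> is 0 by definition, in place of the absent
    \<open>h_q(-1) = 0\<close>; the even recurrence covers positive arguments only.\<close>
  case 0
  then show ?thesis
    using hq_fract_odd[of 0] q_nonzero by (simp add: CW_q_Suc hq_fract_0) (simp add: CW_q_def)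
next
  case (Suc k)
  define u v where "u = hq_fract k" and "v = hq_fract (Suc k)"
  have v: "v \<noteq> 0" by (simp add: v_def hq_fract_nonzero)
  have "q * CW_q (Suc (2 * n)) = q * (v + q\<^sup>2 * u) / (q * v)"
    unfolding Suc CW_q_Suc hq_fract_odd hq_fract_even u_def v_def by simp
  also have "\<dots> = 1 + q * (q * (u / v))"
    using q_nonzero v by (simp add: add_divide_distrib power2_eq_square mult.assoc)
  finally show ?thesis by (simp add: Suc CW_q_Suc u_def v_def)
qed

lemma CW_q_even:
  assumes "n > 0"
  shows "q * CW_q (2 * n) = q * (q * CW_q n) / (1 + q * (q * CW_q n))"
proof -
  obtain k where k: "n = Suc k" using assms by (cases n) auto
  define u v where "u = hq_fract k" and "v = hq_fract (Suc k)"
  have v: "v \<noteq> 0" by (simp add: v_def hq_fract_nonzero)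
  have "2 * n = Suc (Suc (2 * k))" by (simp add: k)
  then have "CW_q (2 * n) = hq_fract (Suc (2 * k)) / hq_fract (2 * Suc k)"
    by (simp add: CW_q_Suc)
  then have "q * CW_q (2 * n) = q * (q * u) / (v + q\<^sup>2 * u)"
    unfolding hq_fract_odd hq_fract_even u_def v_def by simp
  \<comment> \<open>Dividing numerator and denominator by \<open>v\<close> brings out
    \<open>u / v = CW_q n\<close>.\<close>
  also have "\<dots> = (q * (q * u) / v) / ((v + q\<^sup>2 * u) / v)"
    using v by simp
  also have "(v + q\<^sup>2 * u) / v = 1 + q * (q * (u / v))"
    using v by (simp add: add_divide_distrib power2_eq_square mult.assoc)
  also have "q * (q * u) / v = q * (q * (u / v))"
    by simp
  finally show ?thesis by (simp add: k CW_q_Suc u_def v_def)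
qed

section \<open>Stern's sequence under the two Calkin-Wilf moves\<close>

lemma fusc_pos: "n > 0 \<Longrightarrow> fusc n > 0"
proof (induction n rule: nat_bit_induct)
  case (even n)
  then show ?case by (simp add: fusc_double)
next
  case (odd n)
  then show ?case
    using fusc_double_plus_1[of n] by (cases "n = 0") (simp_all add: fusc_1[simplified])
qed simp

lemma CW_0: "CW 0 = 0"
  by (simp add: CW_def fusc_0)

lemma CW_nonneg: "CW n \<ge> 0"
  by (simp add: CW_def)

lemma CW_pos: "n > 0 \<Longrightarrow> CW n > 0"
  by (simp add: CW_def fusc_pos)

lemma CW_odd: "CW (Suc (2 * n)) = 1 + CW n"
proof (cases "n = 0")
  \<comment> \<open>The recursion rules for \<open>fusc\<close> start at 1, so
    \<open>CW 1 = 1\<close> is computed directly.\<close>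
  case True
  then show ?thesis
    using fusc_double[of 1] by (simp add: CW_def fusc_0 fusc_1[simplified] numeral_2_eq_2)
next
  case False
  then have "fusc (Suc (2 * n)) = fusc n + fusc (n + 1)" "fusc (Suc (2 * n) + 1) = fusc (n + 1)"
    using fusc_double_plus_1[of n] fusc_double[of "n + 1"] by simp_all
  then show ?thesis
    using fusc_pos[of "n + 1"] by (simp add: CW_def field_simps)
qed

lemma CW_even:
  assumes "n > 0"
  shows "CW (2 * n) = CW n / (1 + CW n)"
proof -
  have "fusc (2 * n) = fusc n" "fusc (2 * n + 1) = fusc n + fusc (n + 1)"
    using assms fusc_double fusc_double_plus_1 by simp_all
  then show ?thesis
    using fusc_pos[of "n + 1"] fusc_pos[of n] assms
    by (simp add: CW_def divide_simps)
qed

section \<open>Continued fractions\<close>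

text \<open>Since \<open>x / 0 = 0\<close>, the recursions also hold at singleton lists.\<close>

lemma cf_value_Cons: "cf_value (a # as) = of_nat a + 1 / cf_value as"
  by (cases as) simp_all

lemma q_cf_value_Cons: "q_cf_value z (a # as) = q_int z a + z ^ a / q_cf_value (inverse z) as"
  by (cases as) simp_all

lemma cf_value_Suc: "cf_value (Suc a # as) = 1 + cf_value (a # as)"
  by (simp add: cf_value_Cons)

lemma q_int_Suc: "q_int z (Suc a) = 1 + z * q_int z a"
  unfolding q_int_def sum.lessThan_Suc_shift by (simp add: sum_distrib_left)

text \<open>Raising the leading entry multiplies \<open>z ^ a\<close> by \<open>z\<close> and turns
  \<open>q_int z a\<close> into \<open>1 + z * q_int z a\<close>; the tail keeps its base.\<close>

lemma q_cf_value_Suc: "q_cf_value z (Suc a # as) = 1 + z * q_cf_value z (a # as)"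
  by (simp add: q_cf_value_Cons q_int_Suc distrib_left)

lemma cf_value_0_Cons: "cf_value (0 # as) = 1 / cf_value as"
  by (simp add: cf_value_Cons)

text \<open>\<open>q_int z 0 = 0\<close> and \<open>z ^ 0 = 1\<close> leave a bare reciprocal, but
  in the inverted base.\<close>

lemma q_cf_value_0_Cons: "q_cf_value z (0 # as) = 1 / q_cf_value (inverse z) as"
  by (simp add: q_cf_value_Cons q_int_def)

lemma cf_value_nonneg: "cf_value as \<ge> 0"
  by (induction as) (simp_all add: cf_value_Cons)

lemma cf_value_ge_1:
  assumes "\<forall>a\<in>set as. a \<ge> 1" "as \<noteq> []"
  shows "cf_value as \<ge> 1"
proof -
  obtain a r where as: "as = Suc a # r"
    using assms by (cases as) (auto simp: Suc_le_eq gr0_conv_Suc)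
  show ?thesis
    using cf_value_nonneg[of "a # r"] by (simp add: as cf_value_Suc)
qed

text \<open>Turns a vanishing tail value into an empty tail, which pins down the expansions of 0 and
  the exceptional one of 1.\<close>

lemma cf_value_eq_0_iff:
  assumes "\<forall>a\<in>set as. a \<ge> 1"
  shows "cf_value as = 0 \<longleftrightarrow> as = []"
  using cf_value_ge_1[OF assms] by fastforce

lemma cf_expansion_Cons:
  "cf_expansion (a # as) x \<longleftrightarrow> (\<forall>b\<in>set as. b \<ge> 1) \<and> cf_value (a # as) = x"
  by (simp add: cf_expansion_def)

section \<open>Expansions of \<open>CW n\<close> and their deformed values\<close>

text \<open>Existence for the definite description in \<open>q_rational\<close>. The even move reads
  \<open>1 / (1 + 1 / x)\<close>, so it acts only at the front of the list.\<close>

lemma ex_cf_expansion_CW: "\<exists>as. cf_expansion as (CW n)"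
proof (induction n rule: nat_bit_induct)
  case zero
  have "cf_expansion [0] (CW 0)" by (simp add: cf_expansion_def CW_0)
  then show ?case ..
next
  case (even n)
  then obtain a as where as: "\<forall>b\<in>set as. b \<ge> 1" "cf_value (a # as) = CW n"
    by (metis cf_expansion_Cons cf_expansion_def neq_Nil_conv)
  have x: "CW n > 0" using even by (simp add: CW_pos)
  show ?case
  proof (cases a)
    \<comment> \<open>Here \<open>b # r\<close> expands \<open>1 / CW n\<close>, so adding 1 raises
      \<open>b\<close>.\<close>
    case 0
    with as x obtain b r where r: "as = b # r"
      by (cases as) auto
    have "1 / cf_value (b # r) = CW n"
      using as 0 r by (simp add: cf_value_0_Cons)
    then have "cf_value (b # r) = 1 / CW n"
      by (metis div_by_1 divide_divide_eq_right mult_1)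
    then have "cf_value (0 # Suc b # r) = 1 / (1 + 1 / CW n)"
      by (simp only: cf_value_0_Cons cf_value_Suc)
    also have "\<dots> = CW n / (1 + CW n)"
      using x by (simp add: divide_simps)
    finally have "cf_value (0 # Suc b # r) = CW n / (1 + CW n)" .
    then have "cf_expansion (0 # Suc b # r) (CW (2 * n))"
      using even as r by (simp add: cf_expansion_Cons CW_even)
    then show ?thesis ..
  next
    case (Suc c)
    \<comment> \<open>\<open>0 # a # as\<close> expands \<open>1 / CW n\<close>, and adding 1 turns
      its 0 into 1; \<open>a\<close> is positive, hence admissible as an inner entry.\<close>
    have "cf_value (0 # 1 # a # as) = CW n / (1 + CW n)"
      using x unfolding cf_value_0_Cons cf_value_Cons[of 1] as(2)
      by (simp add: divide_simps add.commute)
    then have "cf_expansion (0 # 1 # a # as) (CW (2 * n))"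
      using even as Suc by (simp add: cf_expansion_Cons CW_even)
    then show ?thesis ..
  qed
next
  case (odd n)
  then obtain a as where "\<forall>b\<in>set as. b \<ge> 1" "cf_value (a # as) = CW n"
    by (metis cf_expansion_Cons cf_expansion_def neq_Nil_conv)
  then have "cf_expansion (Suc a # as) (CW (Suc (2 * n)))"
    by (simp add: cf_expansion_Cons cf_value_Suc CW_odd)
  then show ?case ..
qed

text \<open>The list is generalised in the induction because undoing a move yields an expansion of
  \<open>CW n\<close> of no prescribed form.\<close>

lemma q_cf_value_CW:
  "cf_expansion as (CW n) \<Longrightarrow> q_cf_value q as = q * CW_q n"
proof (induction n arbitrary: as rule: nat_bit_induct)
  case zero
  then obtain a r where as: "as = a # r" and r: "\<forall>b\<in>set r. b \<ge> 1"
    and v: "of_nat a + 1 / cf_value r = 0"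
    by (cases as) (auto simp: cf_expansion_def CW_0 cf_value_Cons)
  \<comment> \<open>Both summands are nonnegative, hence both vanish; so \<open>[0]\<close> is the
    only expansion of 0.\<close>
  have "a = 0 \<and> cf_value r = 0"
    using v cf_value_nonneg[of r] by (simp add: add_nonneg_eq_0_iff)
  then show ?case
    using r by (simp add: as cf_value_eq_0_iff q_int_def CW_q_def)
next
  case (even n)
  from even.prems obtain a r where as: "as = a # r" and r: "\<forall>b\<in>set r. b \<ge> 1"
    and v: "cf_value (a # r) = CW n / (1 + CW n)"
    using even.hyps by (cases as) (auto simp: cf_expansion_def CW_even)
  have x: "CW n > 0" using even.hyps by (simp add: CW_pos)
  define y where "y = q * CW_q n"
  have y: "y \<noteq> 0" using even.hyps by (simp add: y_def q_nonzero CW_q_nonzero)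
  \<comment> \<open>\<open>CW (2 * n)\<close> lies below 1, whereas a positive leading entry gives a
    value of at least 1.\<close>
  have "a = 0"
  proof (rule ccontr)
    assume "a \<noteq> 0"
    then obtain c where "a = Suc c" by (cases a) auto
    then have "CW n / (1 + CW n) \<ge> 1"
      using v cf_value_nonneg[of "c # r"] by (simp add: cf_value_Suc flip: v)
    with x show False by (simp add: field_simps)
  qed
  with v have "cf_value r = (1 + CW n) / CW n"
    by (metis cf_value_0_Cons div_by_1 divide_divide_eq_right mult_1 inverse_eq_divide inverse_divide)
  then have v': "cf_value r = 1 + 1 / CW n"
    using x by (simp add: field_simps)
  with x have "r \<noteq> []" by (auto simp: field_simps)
  then obtain b s where rs: "r = Suc b # s"
    using r by (cases r) (auto simp: Suc_le_eq gr0_conv_Suc)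
  have v'': "cf_value (b # s) = 1 / CW n"
    using v' by (simp add: rs cf_value_Suc)
  \<comment> \<open>If \<open>b = 0\<close>, then \<open>s\<close> expands \<open>CW n\<close> and
    its base is inverted back to \<open>q\<close>. Otherwise \<open>b\<close> may stay an inner
    entry, and prefixing 0 gives an expansion of \<open>CW n\<close>.\<close>
  have "q_cf_value (inverse q) (b # s) = 1 / y"
  proof (cases b)
    case 0
    then have s: "cf_value s = CW n"
      using v'' by (simp add: cf_value_0_Cons)
    moreover from this have "s \<noteq> []" using x by auto
    ultimately have "cf_expansion s (CW n)"
      using r by (auto simp: rs cf_expansion_def dest: list.set_sel(2))
    then have "q_cf_value q s = y" unfolding y_def by (rule even.IH)
    then show ?thesis by (simp add: 0 q_cf_value_0_Cons)
  next
    case (Suc c)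
    have "cf_expansion (0 # b # s) (CW n)"
      using r v'' by (simp add: rs cf_expansion_Cons cf_value_0_Cons[of "b # s"] Suc)
    then have "q_cf_value q (0 # b # s) = y" unfolding y_def by (rule even.IH)
    then show ?thesis unfolding q_cf_value_0_Cons by auto
  qed
  \<comment> \<open>The tail is read in base \<open>inverse q\<close>, so its raised head brings the
    factor \<open>inverse q\<close>.\<close>
  then have "q_cf_value (inverse q) r = 1 + inverse q * (1 / y)"
    unfolding rs q_cf_value_Suc by simp
  also have "\<dots> = (1 + q * y) / (q * y)"
    using y q_nonzero by (simp add: field_simps)
  finally have "q_cf_value q as = q * y / (1 + q * y)"
    by (simp add: as \<open>a = 0\<close> q_cf_value_0_Cons)
  then show ?case
    using CW_q_even[OF even.hyps] by (simp add: y_def)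
next
  case (odd n)
  then obtain a r where as: "as = a # r" and r: "\<forall>b\<in>set r. b \<ge> 1"
    and v: "cf_value (a # r) = 1 + CW n"
    by (cases as) (auto simp: cf_expansion_def CW_odd)
  show ?case
  proof (cases a)
    case (Suc c)
    then have "cf_expansion (c # r) (CW n)"
      using r v by (simp add: cf_expansion_Cons cf_value_Suc)
    then have "q_cf_value q (c # r) = q * CW_q n" by (rule odd.IH)
    then show ?thesis by (simp add: as Suc q_cf_value_Suc CW_q_odd)
  next
    case 0
    \<comment> \<open>The only expansion of a number \<open>\<ge> 1\<close> with leading entry \<open>0\<close> is \<open>[0, 1]\<close>.\<close>
    have inv: "1 / cf_value r = 1 + CW n" using v by (simp add: 0 cf_value_0_Cons)
    have "r \<noteq> []" using inv CW_nonneg[of n] by auto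
    then obtain b s where rs: "r = Suc b # s"
      using r by (cases r) (auto simp: Suc_le_eq gr0_conv_Suc)
    have ge: "cf_value r \<ge> 1" using cf_value_ge_1[OF r \<open>r \<noteq> []\<close>] .
    then have "1 / cf_value r \<le> 1" by simp
    with inv CW_nonneg[of n] have "CW n = 0" by simp
    then have "n = 0" using CW_pos[of n] by (cases n) auto
    have "cf_value r = 1" using inv \<open>CW n = 0\<close> ge by (simp add: field_simps)
    then have "of_nat b + 1 / cf_value s = 0" by (simp add: rs cf_value_Suc cf_value_Cons)
    then have "b = 0 \<and> cf_value s = 0"
      using cf_value_nonneg[of s] by (simp add: add_nonneg_eq_0_iff)
    then have "as = [0, 1]"
      using r by (simp add: as 0 rs cf_value_eq_0_iff)
    \<comment> \<open>Both sides equal 1.\<close>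
    then show ?thesis
      using CW_q_odd[of n] \<open>n = 0\<close> by (simp add: q_int_def CW_q_def)
  qed
qed

theorem theorem2p3:
  fixes n :: nat
  shows "q_rational (CW n) = q * CW_q n"
proof (cases "n = 0")
  case True
  then show ?thesis by (simp add: q_rational_def CW_0 CW_q_def)
next
  case False
  obtain as where "cf_expansion as (CW n)"
    using ex_cf_expansion_CW by blast
  \<comment> \<open>Uniqueness holds because \<open>q_cf_value_CW\<close> applies to every
    expansion.\<close>
  then have "(THE y. \<exists>as. cf_expansion as (CW n) \<and> y = q_cf_value q as) = q * CW_q n"
    using q_cf_value_CW by (intro the_equality) (metis, blast)
  then show ?thesis
    using CW_pos[of n] False by (simp add: q_rational_def)
qed

end
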